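(* Suppose that there are a vector $h\in\mathbb{R}^n$ and functions $\hat G_\theta,\overline F_\theta:\mathbb{R}\to\mathbb{R}$ such that the DRCCP and ALSO-X$\underline{\#}$ can be recast as $$v^*=\min_{x\in\mathcal X}\{c^\top x:\hat G_\theta(x^\top h)\le0\}$$ and $$v^{A\underline{\#}}=\min_t\Big\{t:\ x^*\in\arg\min_{x\in\mathcal X}\{\overline F_\theta(x^\top h):c^\top x\le t\},\ \hat G_\theta((x^* )^\top h)\le0\Big\},$$ respectively. If both functions $\hat G_\theta(\cdot)$ and $\overline F_\theta(\cdot)$ are monotone nondecreasing, then ALSO-X# is exact, i.e., $v^{A\#}=v^*$.
   Context: Data. $n,m,I$ are positive integers, $[I]=\{1,\dots,I\}$, $\mathcal X\subseteq\mathbb{R}^n$ is a deterministic set, $c\in\mathbb{R}^n$, $\varepsilon\in(0,1)$, $\theta\ge 0$, $\|\cdot\|$ is a norm on $\mathbb{R}^m$ with dual norm $\|\cdot\|_*$. For $i\in[I]$, $a_i(x)\in\mathbb{R}^m$ and $b_i(x)\in\mathbb{R}$ are affine in $x\in\mathbb{R}^n$. $\tilde\zeta$ is a random vector in $\mathbb{R}^m$ with sub-Gaussian reference distribution $\mathbb{P}_\zeta$ (i.e. $\mathbb{P}_\zeta\{\|\tilde\zeta\|\ge\tau\}\le C_1\exp(-C_2\tau^2)$ for some $C_1,C_2>0$). $(y)_+=\max\{y,0\}$. Put $g(x,\zeta)=\max_{i\in[I]}(\theta\|a_i(x)\|_*+a_i(x)^\top\zeta-b_i(x))$. DRCCP: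 $v^*=\min\{c^\top x: x\in\mathcal X,\ \mathbb{P}_\zeta\{g(x,\tilde\zeta)\le0\}\ge1-\varepsilon\}$. ALSO-X#: $v^{A\#}$ is the minimum (infimum) of all $t$ for which there is $(x^*,\beta^* )\in\arg\min\{\varepsilon\beta+\mathbb{E}_{\mathbb{P}_\zeta}[(g(x,\tilde\zeta)-\beta)_+]: x\in\mathcal X,\ c^\top x\le t,\ \beta\le0\}$ with $\mathbb{P}_\zeta\{g(x^*,\tilde\zeta)\le0\}\ge1-\varepsilon$. ALSO-X$\underline{\#}$: the same with $\beta\in\mathbb{R}$ unconstrained; its value is $v^{A\underline{\#}}$. "Recast" means: for $x\in\mathcal X$, the chance constraint $\mathbb{P}_\zeta\{g(x,\tilde\zeta)\le0\}\ge1-\varepsilon$ holds if and only if $\hat G_\theta(x^\top h)\le0$; and for every $t$, the set of $x$-components of optimal solutions of the lower-level problem $\min\{\varepsilon\beta+\mathbb{E}_{\mathbb{P}_\zeta}[(g(x,\tilde\zeta)-\beta)_+]:x\in\mathcal X,c^\top x\le t,\beta\in\mathbb{R}\}$ of ALSO-X$\underline{\#}$ equals $\arg\min_{x\in\mathcal X}\{\overline F_\theta(x^\top h):c^\top x\le t\}$. Conventions: an infimum over the empty set is $+\infty$; the lower-level minimization problems, and the DRCCP when feasible, are understood to attain their minima. *)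

theory Defs
  imports "HOL-Probability.Probability"
begin

definition is_norm :: "('v::real_vector \<Rightarrow> real) \<Rightarrow> bool" where
  "is_norm N \<longleftrightarrow>
     (\<forall>u. N u = 0 \<longleftrightarrow> u = 0) \<and>
     (\<forall>r u. N (r *\<^sub>R u) = \<bar>r\<bar> * N u) \<and>
     (\<forall>u v. N (u + v) \<le> N u + N v)"

definition dual_norm :: "('v::real_inner \<Rightarrow> real) \<Rightarrow> 'v \<Rightarrow> real" where
  "dual_norm N y = (SUP z\<in>{z. N z \<le> 1}. y \<bullet> z)"

definition affine_map :: "('u::real_vector \<Rightarrow> 'v::real_vector) \<Rightarrow> bool" where
  "affine_map f \<longleftrightarrow> (\<exists>L d. linear L \<and> f = (\<lambda>x. L x + d))"

(* The tail bound is required for nonnegative tau only: for tau tending to minus infinity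
   the left-hand side is 1 while the right-hand side tends to 0. *)
definition sub_Gaussian :: "('v \<Rightarrow> real) \<Rightarrow> 'v measure \<Rightarrow> bool" where
  "sub_Gaussian N P \<longleftrightarrow>
     (\<exists>C1>0. \<exists>C2>0. \<forall>\<tau>\<ge>0.
        measure P {\<zeta> \<in> space P. N \<zeta> \<ge> \<tau>} \<le> C1 * exp (- C2 * \<tau>\<^sup>2))"

definition chance_constraint ::
    "'v measure \<Rightarrow> ('u \<Rightarrow> 'v \<Rightarrow> real) \<Rightarrow> real \<Rightarrow> 'u \<Rightarrow> bool" where
  "chance_constraint P g \<epsilon> x \<longleftrightarrow> measure P {\<zeta> \<in> space P. g x \<zeta> \<le> 0} \<ge> 1 - \<epsilon>"

(* Optimal values are extended reals, so that the infimum over the empty set is infinity. *)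
definition drccp_value ::
    "'v measure \<Rightarrow> ('u::real_inner \<Rightarrow> 'v \<Rightarrow> real) \<Rightarrow> real \<Rightarrow> 'u set \<Rightarrow> 'u \<Rightarrow> ereal" where
  "drccp_value P g \<epsilon> X c = (INF x\<in>{x\<in>X. chance_constraint P g \<epsilon> x}. ereal (c \<bullet> x))"

(* Optimal solutions (x, \<beta>) of the lower-level problem with \<beta> restricted to B:
   B = {..0} gives ALSO-X#, and B = UNIV gives the variant with unconstrained \<beta>. *)
definition lower_level_opt ::
    "'v measure \<Rightarrow> ('u::real_inner \<Rightarrow> 'v \<Rightarrow> real) \<Rightarrow> real \<Rightarrow> 'u set \<Rightarrow> 'u \<Rightarrow> real set \<Rightarrow> real
      \<Rightarrow> ('u \<times> real) set" where
  "lower_level_opt P g \<epsilon> X c B t =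
     {s. is_arg_min (\<lambda>(x, \<beta>). \<epsilon> * \<beta> + (LINT \<zeta>|P. max (g x \<zeta> - \<beta>) 0))
           (\<lambda>(x, \<beta>). x \<in> X \<and> c \<bullet> x \<le> t \<and> \<beta> \<in> B) s}"

definition alsox_value ::
    "'v measure \<Rightarrow> ('u::real_inner \<Rightarrow> 'v \<Rightarrow> real) \<Rightarrow> real \<Rightarrow> 'u set \<Rightarrow> 'u \<Rightarrow> real set \<Rightarrow> ereal" where
  "alsox_value P g \<epsilon> X c B =
     (INF t\<in>{t. \<exists>(x, \<beta>)\<in>lower_level_opt P g \<epsilon> X c B t. chance_constraint P g \<epsilon> x}. ereal t)"

end

theory Submission
  imports Defs
begin

text \<open>
  Every \<open>t\<close> admitted by ALSO-X# comes with a chance-feasible \<open>x\<close> such that \<open>c \<bullet> x \<le> t\<close>, so ALSO-X#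
  never goes below the optimal value of the chance-constrained problem. For the converse, let \<open>x\<close>
  be any chance-feasible point of \<open>X\<close> and solve the lower-level problem at level \<open>t = c \<bullet> x\<close>. Two
  observations show that this level is admitted, so that ALSO-X# does not exceed the cost of \<open>x\<close>.

  With \<open>\<beta>\<close> unconstrained, the lower-level problem minimizes \<open>F (x \<bullet> h)\<close>. Since \<open>F\<close> and \<open>G\<close> increase
  in the same scalar \<open>x \<bullet> h\<close>, a smaller value of \<open>F\<close> forces a smaller scalar and hence keeps \<open>G\<close>
  nonpositive; if the value of \<open>F\<close> cannot be improved, \<open>x\<close> is itself a minimizer. Either way some
  minimizer is chance feasible (\<open>mono_argmin_nonpos\<close>).

  The constraint \<open>\<beta> \<le> 0\<close> costs nothing at a chance-feasible point: the objective is convex in \<open>\<beta>\<close>,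
  and its right derivative at \<open>0\<close> is \<open>\<epsilon>\<close> minus the probability of violation, which is nonnegative.
  Hence a positive optimal \<open>\<beta>\<close> may be replaced by \<open>0\<close> (\<open>nonpos_lower_level_optI\<close>). In terms of risk
  measures: for a fixed \<open>x\<close>, the optimal \<open>\<beta>\<close> form the interval of \<open>(1 - \<epsilon>)\<close>-quantiles, and the chance constraint says
  that the smallest of them is nonpositive.
\<close>

text \<open>
  A chance-feasible \<open>f\<close> is positive with probability at most \<open>\<epsilon>\<close>, so lowering \<open>\<beta> \<ge> 0\<close> to \<open>0\<close> raises
  the expected excess by at most \<open>\<epsilon> * \<beta>\<close>. If the positive part of \<open>f\<close> is not integrable, its
  integral is \<open>0\<close> by convention and the bound is trivial.
\<close>
lemma (in prob_space) expected_excess_le_at_zero: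
  fixes f :: "'a \<Rightarrow> real"
  assumes feasible: "prob {z \<in> space M. f z \<le> 0} \<ge> 1 - \<epsilon>" and "\<beta> \<ge> 0"
  shows "(LINT z|M. max (f z) 0) \<le> \<epsilon> * \<beta> + (LINT z|M. max (f z - \<beta>) 0)"
proof (cases "integrable M (\<lambda>z. max (f z) 0)")
  case False
  have "\<epsilon> \<ge> 0"
    using feasible prob_le_1[of "{z \<in> space M. f z \<le> 0}"] by linarith
  moreover have "(LINT z|M. max (f z - \<beta>) 0) \<ge> 0"
    by (rule integral_nonneg_AE) simp
  ultimately show ?thesis
    using \<open>\<beta> \<ge> 0\<close> by (simp add: not_integrable_integral_eq[OF False])
next
  case int: True
  \<comment> \<open>Only the positive part of \<open>f\<close> is known to be measurable, so everything is expressed through it.\<close>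
  define p where "p = (\<lambda>z. max (f z) 0)"
  define A where "A = {z \<in> space M. p z > 0}"
  have p_int: "integrable M p"
    using int by (simp add: p_def)
  then have p_meas [measurable]: "p \<in> borel_measurable M"
    by simp
  have A_sets [measurable]: "A \<in> sets M"
    unfolding A_def by measurable
  have excess: "max (f z - \<beta>) 0 = max (p z - \<beta>) 0" for z
    using \<open>\<beta> \<ge> 0\<close> by (auto simp: p_def max_def)
  have excess_int: "integrable M (\<lambda>z. max (p z - \<beta>) 0)"
    using p_int by auto
  have A_int: "integrable M (\<lambda>z. \<beta> * indicator A z)"
    by (intro integrable_mult_right integrable_real_indicator A_sets) (simp add: emeasure_eq_measure)
  have "{z \<in> space M. f z \<le> 0} = space M - A"
    by (auto simp: A_def p_def max_def split: if_splits)
  then have A_prob: "prob A \<le> \<epsilon>"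
    using feasible prob_compl[OF A_sets] by simp
  have "(LINT z|M. p z) \<le> (LINT z|M. \<beta> * indicator A z + max (p z - \<beta>) 0)"
    using \<open>\<beta> \<ge> 0\<close>
    by (intro integral_mono p_int Bochner_Integration.integrable_add A_int excess_int)
      (auto simp: A_def p_def indicator_def max_def)
  also have "\<dots> = \<beta> * prob A + (LINT z|M. max (p z - \<beta>) 0)"
    using A_sets by (subst Bochner_Integration.integral_add[OF A_int excess_int]) simp
  also have "\<dots> \<le> \<epsilon> * \<beta> + (LINT z|M. max (p z - \<beta>) 0)"
    using mult_left_mono[OF A_prob \<open>\<beta> \<ge> 0\<close>] by (simp add: mult.commute)
  finally show ?thesis
    by (simp only: excess p_def[symmetric])
qed

text \<open>
  The clipped pair has an objective value no larger than that of the given optimal pair, and it is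
  feasible for the unconstrained problem, hence optimal there and a fortiori over \<open>\<beta> \<le> 0\<close>.
\<close>
lemma nonpos_lower_level_optI:
  assumes "prob_space P"
    and opt: "(x, \<beta>) \<in> lower_level_opt P g \<epsilon> X c UNIV t"
    and feasible: "chance_constraint P g \<epsilon> x"
  shows "(x, min \<beta> 0) \<in> lower_level_opt P g \<epsilon> X c {..0} t"
proof -
  interpret prob_space P by fact
  define obj where "obj = (\<lambda>(x, \<beta>). \<epsilon> * \<beta> + (LINT \<zeta>|P. max (g x \<zeta> - \<beta>) 0))"
  have "obj (x, 0) \<le> obj (x, \<beta>)" if "\<beta> \<ge> 0"
    using expected_excess_le_at_zero[where f = "g x"] feasible that
    by (simp add: obj_def chance_constraint_def)
  then have clipped: "obj (x, min \<beta> 0) \<le> obj (x, \<beta>)"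
    by (simp add: min_def)
  show ?thesis
    using opt clipped
    unfolding lower_level_opt_def is_arg_min_def obj_def[symmetric]
    by (auto simp: not_less intro: order_trans)
qed

text \<open>
  A strict decrease of \<open>F\<close> from \<open>f x\<close> to \<open>f y\<close> forces \<open>f y < f x\<close>; without a strict decrease, \<open>x\<close> is
  itself a minimizer.
\<close>
lemma mono_argmin_nonpos:
  fixes f :: "'a \<Rightarrow> 's::linorder" and F :: "'s \<Rightarrow> 'b::linorder" and G :: "'s \<Rightarrow> 'c::{order,zero}"
  assumes "mono F" "mono G"
    and y: "is_arg_min (\<lambda>z. F (f z)) S y"
    and x: "S x" "G (f x) \<le> 0"
  obtains z where "is_arg_min (\<lambda>z. F (f z)) S z" "G (f z) \<le> 0"
proof (cases "F (f y) < F (f x)")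
  case True
  then have "f y \<le> f x"
    using \<open>mono F\<close> by (meson monoD not_le order.strict_implies_order)
  then have "G (f y) \<le> 0"
    using monoD[OF \<open>mono G\<close>] x(2) order_trans by blast
  then show thesis
    using that y by blast
next
  case False
  then have "is_arg_min (\<lambda>z. F (f z)) S x"
    using x(1) y by (auto simp: is_arg_min_linorder intro: order_trans)
  then show thesis
    using that x(2) by blast
qed

lemma drccp_value_le_alsox_value: "drccp_value P g \<epsilon> X c \<le> alsox_value P g \<epsilon> X c B"
  unfolding alsox_value_def
proof (rule INF_greatest)
  fix t
  assume "t \<in> {t. \<exists>(x, \<beta>)\<in>lower_level_opt P g \<epsilon> X c B t. chance_constraint P g \<epsilon> x}"
  then obtain x where x: "x \<in> X" "c \<bullet> x \<le> t" "chance_constraint P g \<epsilon> x"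
    by (auto simp: lower_level_opt_def is_arg_min_def)
  then have "drccp_value P g \<epsilon> X c \<le> ereal (c \<bullet> x)"
    unfolding drccp_value_def by (intro INF_lower) simp
  also have "\<dots> \<le> ereal t"
    using x(2) by simp
  finally show "drccp_value P g \<epsilon> X c \<le> ereal t" .
qed

theorem theorem8:
  fixes I :: nat
    and X :: "(real ^ 'n) set"
    and c h :: "real ^ 'n"
    and \<epsilon> \<theta> :: real
    and N :: "real ^ 'm \<Rightarrow> real"
    and a :: "nat \<Rightarrow> real ^ 'n \<Rightarrow> real ^ 'm"
    and b :: "nat \<Rightarrow> real ^ 'n \<Rightarrow> real"
    and P :: "(real ^ 'm) measure"
    and g :: "real ^ 'n \<Rightarrow> real ^ 'm \<Rightarrow> real"
    and G F :: "real \<Rightarrow> real"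
  assumes "I \<ge> 1"
    and "0 < \<epsilon>" "\<epsilon> < 1"
    and "\<theta> \<ge> 0"
    and "is_norm N"
    and "\<And>i. i \<in> {1..I} \<Longrightarrow> affine_map (a i)"
    and "\<And>i. i \<in> {1..I} \<Longrightarrow> affine_map (b i)"
    and "prob_space P" "sets P = sets borel"
    and "sub_Gaussian N P"
    and g_eq: "g = (\<lambda>x \<zeta>. MAX i\<in>{1..I}. \<theta> * dual_norm N (a i x) + a i x \<bullet> \<zeta> - b i x)"
    and drccp_attained:
      "(\<exists>x\<in>X. chance_constraint P g \<epsilon> x) \<Longrightarrow>
         \<exists>x. is_arg_min (\<lambda>x. c \<bullet> x) (\<lambda>x. x \<in> X \<and> chance_constraint P g \<epsilon> x) x"
    and lower_level_attained:
      "\<And>t B. B \<in> {{..0}, UNIV} \<Longrightarrow> \<exists>x\<in>X. c \<bullet> x \<le> t \<Longrightarrow> lower_level_opt P g \<epsilon> X c B t \<noteq> {}"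
    and drccp_recast:
      "\<And>x. x \<in> X \<Longrightarrow> chance_constraint P g \<epsilon> x \<longleftrightarrow> G (x \<bullet> h) \<le> 0"
    and lower_level_recast:
      "\<And>t. fst ` lower_level_opt P g \<epsilon> X c UNIV t =
             {x. is_arg_min (\<lambda>x. F (x \<bullet> h)) (\<lambda>x. x \<in> X \<and> c \<bullet> x \<le> t) x}"
    and "mono G" "mono F"
  shows "alsox_value P g \<epsilon> X c {..0} = drccp_value P g \<epsilon> X c"
proof (rule antisym[OF _ drccp_value_le_alsox_value])
  have "alsox_value P g \<epsilon> X c {..0} \<le> ereal (c \<bullet> x)"
    if x: "x \<in> X" "chance_constraint P g \<epsilon> x" for x
  proof -
    define S where "S = (\<lambda>z. z \<in> X \<and> c \<bullet> z \<le> c \<bullet> x)"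
    have recast: "fst ` lower_level_opt P g \<epsilon> X c UNIV (c \<bullet> x) = {z. is_arg_min (\<lambda>z. F (z \<bullet> h)) S z}"
      unfolding S_def by (rule lower_level_recast)
    have "lower_level_opt P g \<epsilon> X c UNIV (c \<bullet> x) \<noteq> {}"
      using lower_level_attained x(1) by auto
    then obtain y where "is_arg_min (\<lambda>z. F (z \<bullet> h)) S y"
      using recast by blast
    moreover have "S x" "G (x \<bullet> h) \<le> 0"
      using x drccp_recast by (auto simp: S_def)
    ultimately obtain z where z: "is_arg_min (\<lambda>z. F (z \<bullet> h)) S z" "G (z \<bullet> h) \<le> 0"
      using mono_argmin_nonpos[OF \<open>mono F\<close> \<open>mono G\<close>, where f = "\<lambda>z. z \<bullet> h"] by blast
    then have feasible: "chance_constraint P g \<epsilon> z"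
      using drccp_recast by (simp add: is_arg_min_def S_def)
    from z(1) recast have "z \<in> fst ` lower_level_opt P g \<epsilon> X c UNIV (c \<bullet> x)"
      by simp
    then obtain \<beta> where "(z, \<beta>) \<in> lower_level_opt P g \<epsilon> X c UNIV (c \<bullet> x)"
      by force
    then have "(z, min \<beta> 0) \<in> lower_level_opt P g \<epsilon> X c {..0} (c \<bullet> x)"
      using nonpos_lower_level_optI[OF \<open>prob_space P\<close>] feasible by blast
    then show ?thesis
      using feasible unfolding alsox_value_def by (intro INF_lower) blast
  qed
  then show "alsox_value P g \<epsilon> X c {..0} \<le> drccp_value P g \<epsilon> X c"
    unfolding drccp_value_def by (intro INF_greatest) simp
qed

end
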